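(* Let $k<t$ be positive integers such that $k$ is odd, $t \geq 898$ is even and $k,t$ are coprime (so that the distance graph $D(k,t)$ is connected). Then $\chi_{\rho}(D(k,t)) \leq 56$.
   Context: For positive integers $k<t$, the distance graph $D(k,t)$ is the infinite simple undirected graph with vertex set $\mathbb{Z}$ in which two distinct integers $i,j$ are adjacent if and only if $|i-j|\in\{k,t\}$. For a connected graph $G$, $\mathrm{dist}_G(u,v)$ denotes the graph distance. For a positive integer $i$, an $i$-packing is a set $X_i$ of vertices such that any two distinct $u,v\in X_i$ satisfy $\mathrm{dist}_G(u,v)>i$. A packing $p$-coloring of $G$ is a partition of $V(G)$ into disjoint (possibly empty) classes $X_1,\dots,X_p$ such that each $X_i$ is an $i$-packing. The packing chromatic number $\chi_\rho(G)$ is the smallest integer $p$ for which $G$ has a packing $p$-coloring. *)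

theory Defs
  imports
    "Graph_Theory.Pair_Digraph"
    "Graph_Theory.Shortest_Path"
    "HOL-Library.Disjoint_Sets"
    "HOL-Library.Extended_Nat"
begin

text \<open>
  A simple undirected graph is represented by a symmetric loop-free digraph without parallel
  arcs: each undirected edge is the pair of its two opposite arcs.
\<close>

definition distance_graph :: "nat \<Rightarrow> nat \<Rightarrow> int pair_pre_digraph" where
  "distance_graph k t =
     \<lparr> pverts = UNIV, parcs = {(i, j). i \<noteq> j \<and> \<bar>i - j\<bar> \<in> {int k, int t}} \<rparr>"

lemma pair_bidirected_digraph_distance_graph:
  "pair_bidirected_digraph (distance_graph k t)"
  by unfold_locales
     (auto simp: distance_graph_def symmetric_def sym_def abs_minus_commute)

text \<open>
  With unit arc weights the weighted shortest-path length is the usual graph distance; it is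
  \<open>\<infinity>\<close> between vertices that are not joined by a walk. The constant
  \<open>wf_digraph.\<mu>\<close> is only specified for well-formed digraphs.
\<close>

definition graph_dist :: "'a pair_pre_digraph \<Rightarrow> 'a \<Rightarrow> 'a \<Rightarrow> ereal" where
  "graph_dist G = wf_digraph.\<mu> (with_proj G) (\<lambda>_. 1)"

lemma (in pair_wf_digraph) graph_dist_eq_Inf_walk_length:
  "graph_dist G u v = (INF p \<in> {p. awalk u p v}. ereal (real (length p)))"
proof -
  have "awalk_cost (\<lambda>_. 1) p = real (length p)" for p :: "('a \<times> 'a) awalk"
    by (induction p) auto
  then show ?thesis
    by (simp add: graph_dist_def \<mu>_def)
qed

definition is_packing :: "'a pair_pre_digraph \<Rightarrow> nat \<Rightarrow> 'a set \<Rightarrow> bool" where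
  "is_packing G i X \<longleftrightarrow>
     X \<subseteq> pverts G \<and> (\<forall>u\<in>X. \<forall>v\<in>X. u \<noteq> v \<longrightarrow> graph_dist G u v > ereal (real i))"

text \<open>
  Only the classes \<open>X 1, \<dots>, X p\<close> matter, and they may be empty.
\<close>

definition is_packing_coloring :: "'a pair_pre_digraph \<Rightarrow> nat \<Rightarrow> (nat \<Rightarrow> 'a set) \<Rightarrow> bool" where
  "is_packing_coloring G p X \<longleftrightarrow>
     disjoint_family_on X {1..p} \<and> (\<Union>i\<in>{1..p}. X i) = pverts G \<and>
     (\<forall>i\<in>{1..p}. is_packing G i (X i))"

text \<open>
  The value is \<open>\<infinity>\<close> if no finite number of classes suffices, so a finite upper bound
  includes the existence of a packing coloring.
\<close>

definition packing_chromatic_number :: "'a pair_pre_digraph \<Rightarrow> enat" where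
  "packing_chromatic_number G = Inf {enat p | p. \<exists>X. is_packing_coloring G p X}"

end

theory Submission
  imports Defs
begin

text \<open>
  Send the integer point \<open>(a, b)\<close> of the plane to the vertex \<open>a k + b t\<close>. Grid steps become edges,
  every vertex is reached because \<open>k\<close> and \<open>t\<close> are coprime, and two points meet in one vertex exactly
  if they differ by a multiple of \<open>(t, - k)\<close>. So \<open>D(k,t)\<close> is the square grid rolled up to a cylinder,
  and it suffices to color the grid so that equal colors \<open>c\<close> lie at \<open>L\<^sub>1\<close>-distance more than \<open>c\<close>
  (\<open>plane_packing\<close>) and the coloring is invariant under \<open>(t, - k)\<close>
  (\<open>packing_chromatic_number_le_plane_packing\<close>).

  The grid has a doubly periodic packing coloring with 17 colors: color 1 on one class of the
  checkerboard, and \<open>pattern\<close> on the other. Its periods form a lattice of index 1024 that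
  usually misses \<open>(t, - k)\<close>. The remedy is to cut the pattern along vertical lines and to insert a
  column of new colors, a seam, into each cut. A seam moves the part to its right by one unit to the
  right, and this part may also slide up or down by one unit. Distances across the seam do not
  shrink: reading the position in the pattern off the position in the grid,
  \<open>(a, b) \<mapsto> (X a, b + Y a)\<close>, is a map that does not increase \<open>L\<^sub>1\<close>-distances (\<open>contraction\<close>), so the
  pulled back pattern is again a packing coloring outside the seams. With \<open>S\<close> seams, of which \<open>I\<close>
  slide one way and \<open>S - I\<close> the other, once around the cylinder is a displacement by
  \<open>(t - 1 - S, 2 I - S - k)\<close> in the pattern, and some \<open>I \<le> S \<le> 42\<close> makes this a period
  (\<open>seam_numbers\<close>).

  A sliding seam preserves the checkerboard, so half of it keeps color 1 and the rest takes the
  colors 18 to 35. Since \<open>t + k\<close> is odd, the cylinder is not bipartite, and the checkerboard has to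
  break somewhere: this happens at a single defect column without color 1, which has the
  colors 18 to 55 in a packing coloring of a path and accounts for the \<open>1\<close> in \<open>t - 1 - S\<close>. The defect
  column and up to 42 seams have to stay apart from each other around the cylinder, and \<open>t \<ge> 898\<close>
  leaves enough room for them.
\<close>

section \<open>Distances in \<open>D(k,t)\<close> and packings of the plane\<close>

lemma distance_graph_awalk_displacement:
  assumes "pre_digraph.awalk (with_proj (distance_graph k t)) u w v"
  shows "\<exists>p q. v = u + p * int k + q * int t \<and> \<bar>p\<bar> + \<bar>q\<bar> \<le> int (length w)"
proof -
  interpret pair_bidirected_digraph "distance_graph k t"
    by (rule pair_bidirected_digraph_distance_graph)
  from assms show ?thesis
  proof (induction w arbitrary: u)
    case Nil
    then have "v = u + 0 * int k + 0 * int t" by (simp add: awalk_Nil_iff)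
    then show ?case by (intro exI[of _ 0]) simp
  next
    case (Cons e w)
    then have e: "e \<in> parcs (distance_graph k t)" "fst e = u"
      and walk: "awalk (snd e) w v"
      by (auto simp: awalk_Cons_iff)
    from Cons.IH[OF walk] obtain p q where pq:
      "v = snd e + p * int k + q * int t" "\<bar>p\<bar> + \<bar>q\<bar> \<le> int (length w)" by blast
    have "\<bar>u - snd e\<bar> = int k \<or> \<bar>u - snd e\<bar> = int t"
      using e by (auto simp: distance_graph_def)
    then consider "snd e = u + int k" | "snd e = u - int k"
      | "snd e = u + int t" | "snd e = u - int t" by linarith
    then show ?case
    proof cases
      case 1
      with pq show ?thesis by (intro exI[of _ "p + 1"] exI[of _ q]) (auto simp: algebra_simps)
    next
      case 2
      with pq show ?thesis by (intro exI[of _ "p - 1"] exI[of _ q]) (auto simp: algebra_simps)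
    next
      case 3
      with pq show ?thesis by (intro exI[of _ p] exI[of _ "q + 1"]) (auto simp: algebra_simps)
    next
      case 4
      with pq show ?thesis by (intro exI[of _ p] exI[of _ "q - 1"]) (auto simp: algebra_simps)
    qed
  qed
qed

lemma distance_graph_dist_le_displacement:
  assumes "graph_dist (distance_graph k t) u v \<le> ereal (real i)"
  shows "\<exists>p q. v = u + p * int k + q * int t \<and> \<bar>p\<bar> + \<bar>q\<bar> \<le> int i"
proof -
  interpret pair_bidirected_digraph "distance_graph k t"
    by (rule pair_bidirected_digraph_distance_graph)
  have "graph_dist (distance_graph k t) u v < ereal (real (i + 1))"
    using assms by (rule order.strict_trans1) simp
  then obtain w where w: "awalk u w v" "length w < i + 1"
    unfolding graph_dist_eq_Inf_walk_length INF_less_iff by auto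
  from distance_graph_awalk_displacement[OF w(1)] w(2) show ?thesis
    by (metis Suc_eq_plus1 less_Suc_eq_le of_nat_mono order_trans)
qed

definition plane_packing :: "(int \<Rightarrow> int \<Rightarrow> int) \<Rightarrow> bool" where
  "plane_packing F \<longleftrightarrow>
     (\<forall>a b a' b'. (a, b) \<noteq> (a', b') \<longrightarrow> F a b = F a' b' \<longrightarrow> F a b < \<bar>a' - a\<bar> + \<bar>b' - b\<bar>)"

text \<open>
  Walks lift from \<open>D(k,t)\<close> to the grid with the same length, so two vertices at distance at most \<open>i\<close>
  lift to two grid points at \<open>L\<^sub>1\<close>-distance at most \<open>i\<close>.
\<close>

lemma packing_chromatic_number_le_plane_packing:
  fixes F :: "int \<Rightarrow> int \<Rightarrow> int"
  assumes "coprime k t" and "0 < t"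
    and packing: "plane_packing F"
    and range: "\<And>a b. 1 \<le> F a b \<and> F a b \<le> int c"
    and period: "\<And>a b. F (a + int t) (b - int k) = F a b"
  shows "packing_chromatic_number (distance_graph k t) \<le> enat c"
proof -
  have period_nat: "F (a + int t * int m) (b - int k * int m) = F a b" for a b m
  proof (induction m)
    case (Suc m)
    then show ?case
      using period[of "a + int t * int m" "b - int k * int m"] by (simp add: algebra_simps)
  qed simp
  have period_int: "F (a + int t * m) (b - int k * m) = F a b" for a b m
  proof (cases "m \<ge> 0")
    case True
    then show ?thesis using period_nat[of a "nat m" b] by simp
  next
    case False
    then show ?thesis
      using period_nat[of "a + int t * m" "nat (- m)" "b - int k * m"] by simp
  qed
  have well_defined: "F a b = F a' b'"
    if eq: "a * int k + b * int t = a' * int k + b' * int t" for a b a' b'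
  proof -
    have "int t dvd (a' - a) * int k"
      using eq by (intro dvdI[of _ _ "b - b'"]) (simp add: algebra_simps)
    then have "int t dvd a' - a"
      using assms(1) by (simp add: coprime_dvd_mult_left_iff coprime_commute)
    then obtain m where m: "a' = a + int t * m" by (metis add.commute diff_add_cancel dvdE)
    with eq have "int t * b' = int t * (b - int k * m)" by (simp add: algebra_simps)
    with \<open>0 < t\<close> have "b' = b - int k * m" by simp
    with m show ?thesis using period_int[of a m b] by simp
  qed
  have "\<exists>a b. n = a * int k + b * int t" for n :: int
  proof -
    obtain x y where "x * int k + y * int t = 1"
      using assms(1) bezout_int[of "int k" "int t"] by auto
    then have "n * x * int k + n * y * int t = n"
      by (metis distrib_left mult.assoc mult.right_neutral)
    then show ?thesis by metis
  qed
  then obtain A B where AB: "\<And>n. n = A n * int k + B n * int t" by metis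
  define col where "col n = F (A n) (B n)" for n
  have col: "col n = F a b" if "n = a * int k + b * int t" for n a b
    unfolding col_def by (rule well_defined) (metis AB that)
  have far: "int i < \<bar>p\<bar> + \<bar>q\<bar>"
    if "col u = int i" "col v = int i" "u \<noteq> v" "v = u + p * int k + q * int t" for u v p q i
  proof -
    have "col u = F (A u) (B u)" by (simp add: col_def)
    moreover have "col v = F (A u + p) (B u + q)"
      by (rule col) (use that(4) AB[of u] in \<open>simp add: algebra_simps\<close>)
    moreover have "(A u, B u) \<noteq> (A u + p, B u + q)" using that(3,4) by auto
    ultimately show ?thesis
      using packing that(1,2) unfolding plane_packing_def
      by (metis add_diff_cancel_left')
  qed
  define X where "X i = {n. col n = int i}" for i
  have "is_packing (distance_graph k t) i (X i)" for i
    unfolding is_packing_def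
  proof (intro conjI ballI impI)
    fix u v assume uv: "u \<in> X i" "v \<in> X i" "u \<noteq> v"
    show "ereal (real i) < graph_dist (distance_graph k t) u v"
    proof (rule ccontr)
      assume "\<not> ereal (real i) < graph_dist (distance_graph k t) u v"
      then obtain p q where "v = u + p * int k + q * int t" "\<bar>p\<bar> + \<bar>q\<bar> \<le> int i"
        using distance_graph_dist_le_displacement[of k t u v i] unfolding not_less by auto
      with far[of u i v p q] uv show False by (auto simp: X_def)
    qed
  qed (simp add: distance_graph_def)
  moreover have "disjoint_family_on X {1..c}"
    by (auto simp: disjoint_family_on_def X_def)
  moreover have "(\<Union>i\<in>{1..c}. X i) = UNIV"
  proof -
    have "n \<in> X (nat (col n)) \<and> nat (col n) \<in> {1..c}" for n
      using range[of "A n" "B n"] by (auto simp: X_def col_def)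
    then show ?thesis by blast
  qed
  ultimately have "is_packing_coloring (distance_graph k t) c X"
    by (simp add: is_packing_coloring_def distance_graph_def)
  then show ?thesis
    unfolding packing_chromatic_number_def by (intro Inf_lower) blast
qed

section \<open>A periodic packing coloring of the plane with 17 colors\<close>

text \<open>
  The checkerboard class without color 1 is split once more. Its points with odd first coordinate
  take the colors 2 and 3 alternately. The remaining points have the form \<open>(2 x, 2 y + 1)\<close>, and in the
  coordinates \<open>x, y\<close> distances are halved, so that the colors \<open>2 m\<close> and \<open>2 m + 1\<close> both ask for distance
  more than \<open>m\<close>. The colors 4 to 17 can share this coarser grid: best possible densities
  \<open>1/5, 1/8, 1/13, 1/18, 1/25, 1/32, 1/41\<close>, two of each, leave about a tenth to spare. The table below
  is such a coloring and was found by simulated annealing over many period lattices. The row \<open>y = 0\<close>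
  has period 128, going up by one row shifts it by 19 and swaps \<open>4, 12, 14\<close> with \<open>5, 13, 15\<close>.
\<close>

definition row :: "int list" where
  "row =
    [4, 5, 7, 15, 16, 6, 5, 4,  9, 12, 7, 5,  4, 6, 10, 16,
     5, 4, 7, 15, 10, 6, 4, 5, 11, 12, 7, 4,  5, 6, 11,  9,
     4, 5, 7, 15, 11, 6, 5, 4,  9, 12, 7, 5,  4, 6, 10,  8,
     5, 4, 7, 15,  8, 6, 4, 5, 12,  8, 7, 4,  5, 6,  8,  9,
     4, 5, 7, 15, 17, 6, 5, 4,  9, 12, 7, 5,  4, 6, 11, 17,
     5, 4, 7, 15, 11, 6, 4, 5, 10, 12, 7, 4,  5, 6, 10,  9,
     4, 5, 7, 15, 10, 6, 5, 4,  9, 12, 7, 5,  4, 6, 11,  8,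
     5, 4, 7, 15,  8, 6, 4, 5, 12,  8, 7, 4,  5, 6,  8,  9]"

definition swap :: "int \<Rightarrow> int" where
  "swap c = (if c \<in> {4, 12, 14} then c + 1 else if c \<in> {5, 13, 15} then c - 1 else c)"

definition coarse :: "int \<Rightarrow> int \<Rightarrow> int" where
  "coarse x y =
     (let c = row ! nat ((x - 19 * y) mod 128) in if even y then c else swap c)"

text \<open>
  Because each row is a shift of the one below up to the swap, a whole row is compared at once with
  the row displaced by \<open>(u, v)\<close>, by rotating the table. Only displacements of length at most 8 matter,
  since the colors are less than \<open>2 * 9\<close>, and by symmetry only those with \<open>v \<ge> 0\<close>.
\<close>

definition offset_ok :: "int \<Rightarrow> int \<Rightarrow> bool" where
  "offset_ok v u \<longleftrightarrow> (u = 0 \<and> v = 0) \<or>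
     list_all2 (\<lambda>c d. c \<noteq> d \<or> c < 2 * (\<bar>u\<bar> + \<bar>v\<bar>)) row
       (rotate (nat ((u - 19 * v) mod 128)) (if even v then row else map swap row))"

definition offset_row_ok :: "int \<Rightarrow> bool" where
  "offset_row_ok v \<longleftrightarrow> list_all (offset_ok v) [v - 8..8 - v]"

lemma offset_rows_ok: "list_all offset_row_ok [0..8]"
  by code_simp

lemma offset_ok:
  assumes "0 \<le> v" "\<bar>u\<bar> + v \<le> 8"
  shows "offset_ok v u"
proof -
  have "v \<in> set [0..8]" "u \<in> set [v - 8..8 - v]"
    using assms unfolding set_upto atLeastAtMost_iff by linarith+
  then show ?thesis
    using offset_rows_ok unfolding offset_row_ok_def list_all_iff by blast
qed

lemma row_range: "\<forall>c\<in>set row. 4 \<le> c \<and> c \<le> 17"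
  by (simp add: row_def)

lemma length_row: "length row = 128"
  by (simp add: row_def)

lemma row_nth_range: "4 \<le> row ! nat (z mod 128) \<and> row ! nat (z mod 128) \<le> 17"
proof -
  have "nat (z mod 128) < length row" by (simp add: length_row nat_less_iff)
  then show ?thesis using row_range nth_mem by blast
qed

lemma swap_swap: "swap (swap c) = c"
  by (auto simp: swap_def)

text \<open>
  The swap exchanges the colors \<open>2 m\<close> and \<open>2 m + 1\<close>, which have the same distance requirement in the
  coarse grid. This reduces odd rows to even ones.
\<close>

lemma swap_less_even_iff: "swap c < 2 * n \<longleftrightarrow> c < 2 * n"
  unfolding swap_def by (cases "c \<in> {4, 5, 12, 13, 14, 15}") auto

lemma coarse_range: "4 \<le> coarse x y \<and> coarse x y \<le> 17"
  using row_nth_range[of "x - 19 * y"] by (auto simp: coarse_def Let_def swap_def)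

lemma coarse_period:
  assumes "even v" "128 dvd u - 19 * v"
  shows "coarse (x + u) (y + v) = coarse x y"
proof -
  have "(x + u - 19 * (y + v)) mod 128 = ((x - 19 * y) + (u - 19 * v)) mod 128"
    by (simp add: algebra_simps)
  also have "\<dots> = (x - 19 * y) mod 128"
    using assms(2) by (metis add.right_neutral mod_add_right_eq mod_0_imp_dvd dvd_imp_mod_0)
  finally show ?thesis using assms(1) by (simp add: coarse_def)
qed

lemma coarse_packing_even:
  assumes "(u, v) \<noteq> (0, 0)" "0 \<le> v" "coarse x y = coarse (x + u) (y + v)" "even y"
  shows "coarse x y < 2 * (\<bar>u\<bar> + \<bar>v\<bar>)"
proof (cases "\<bar>u\<bar> + \<bar>v\<bar> \<le> 8")
  case False
  then have "9 \<le> \<bar>u\<bar> + \<bar>v\<bar>" by simp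
  then show ?thesis using coarse_range[of x y] by auto
next
  case True
  define s where "s = nat ((u - 19 * v) mod 128)"
  define z where "z = nat ((x - 19 * y) mod 128)"
  let ?r = "if even v then row else map swap row"
  have z: "z < 128" by (simp add: z_def nat_less_iff)
  have "offset_ok v u" using assms(2) True by (intro offset_ok) auto
  with assms(1) have
    "list_all2 (\<lambda>c d. c \<noteq> d \<or> c < 2 * (\<bar>u\<bar> + \<bar>v\<bar>)) row (rotate s ?r)"
    by (auto simp: offset_ok_def s_def)
  then have ok: "row ! z \<noteq> rotate s ?r ! z \<or> row ! z < 2 * (\<bar>u\<bar> + \<bar>v\<bar>)"
    using z by (auto simp: list_all2_conv_all_nth length_row)
  have "(s + z) mod 128 = nat ((x + u - 19 * (y + v)) mod 128)"
  proof -
    have "int ((s + z) mod 128) = ((u - 19 * v) + (x - 19 * y)) mod 128"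
      by (simp add: s_def z_def zmod_int mod_add_eq)
    also have "\<dots> = (x + u - 19 * (y + v)) mod 128" by (simp add: algebra_simps)
    finally show ?thesis by linarith
  qed
  then have "rotate s ?r ! z = coarse (x + u) (y + v)"
    using z assms(4) by (simp add: nth_rotate length_row coarse_def Let_def)
  with ok assms show ?thesis by (simp add: coarse_def z_def)
qed

lemma coarse_Suc: "coarse x y = swap (coarse (x + 19) (y + 1))"
  by (simp add: coarse_def Let_def swap_swap)

lemma coarse_packing_up:
  assumes "(u, v) \<noteq> (0, 0)" "0 \<le> v" "coarse x y = coarse (x + u) (y + v)"
  shows "coarse x y < 2 * (\<bar>u\<bar> + \<bar>v\<bar>)"
proof (cases "even y")
  case True
  with assms show ?thesis by (rule coarse_packing_even)
next
  case False
  have "coarse (x + 19) (y + 1) = coarse (x + 19 + u) (y + 1 + v)"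
    using assms(3) coarse_Suc[of x y] coarse_Suc[of "x + u" "y + v"]
    by (metis add.commute add.left_commute swap_swap)
  then have "coarse (x + 19) (y + 1) < 2 * (\<bar>u\<bar> + \<bar>v\<bar>)"
    using assms(1,2) False by (intro coarse_packing_even) auto
  then show ?thesis using swap_less_even_iff coarse_Suc[of x y] by metis
qed

lemma coarse_packing:
  assumes "(u, v) \<noteq> (0, 0)" "coarse x y = coarse (x + u) (y + v)"
  shows "coarse x y < 2 * (\<bar>u\<bar> + \<bar>v\<bar>)"
proof (cases "0 \<le> v")
  case True
  with assms show ?thesis by (intro coarse_packing_up) auto
next
  case False
  have "coarse (x + u) (y + v) < 2 * (\<bar>- u\<bar> + \<bar>- v\<bar>)"
    using assms False by (intro coarse_packing_up) auto
  with assms(2) show ?thesis by simp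
qed

definition pattern :: "int \<Rightarrow> int \<Rightarrow> int" where
  "pattern x y =
     (if even x then coarse (x div 2) (y div 2) else if (x + y) mod 4 = 1 then 2 else 3)"

lemma pattern_range: "2 \<le> pattern x y \<and> pattern x y \<le> 17"
  using coarse_range[of "x div 2" "y div 2"] by (auto simp: pattern_def)

lemma pattern_coarse_iff: "4 \<le> pattern x y \<longleftrightarrow> even x"
  using coarse_range[of "x div 2" "y div 2"] by (simp add: pattern_def)

lemma pattern_period:
  assumes "4 dvd v" "256 dvd u - 19 * v"
  shows "pattern (x + u) (y + v) = pattern x y"
proof -
  obtain w where w: "v = 4 * w" using assms(1) by blast
  obtain m where m: "u - 19 * v = 256 * m" using assms(2) by blast
  have u: "u = 2 * (128 * m + 38 * w)" using m w by simp
  have "coarse (x div 2 + (128 * m + 38 * w)) (y div 2 + 2 * w) = coarse (x div 2) (y div 2)"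
    by (rule coarse_period) auto
  moreover have "(x + u + (y + v)) mod 4 = (x + y) mod 4"
  proof -
    have "x + u + (y + v) = (x + y) + 4 * (64 * m + 20 * w)" by (simp add: u w)
    then show ?thesis by (simp only: mod_mult_self2)
  qed
  moreover have "(x + u) div 2 = x div 2 + (128 * m + 38 * w)" by (simp add: u)
  moreover have "(y + v) div 2 = y div 2 + 2 * w"
  proof -
    have "y + v = y + 2 * (2 * w)" by (simp add: w)
    then show ?thesis by simp
  qed
  moreover have "even u" unfolding u by simp
  then have "even (x + u) = even x" by simp
  ultimately show ?thesis by (simp only: pattern_def)
qed

text \<open>
  Points of color 2, and likewise of color 3, differ by \<open>(dx, dy)\<close> with both entries even and sum
  divisible by 4, so their distance is even and not 2. The other colors inherit their distances from
  the coarse grid.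
\<close>

lemma pattern_packing:
  assumes "odd (x + y)" "odd (x' + y')" "(x, y) \<noteq> (x', y')" "pattern x y = pattern x' y'"
  shows "pattern x y < \<bar>x' - x\<bar> + \<bar>y' - y\<bar>"
proof (cases "even x")
  case True
  have "even x'"
    using assms(4) True pattern_coarse_iff by metis
  obtain X where X: "x = 2 * X" using True by blast
  obtain X' where X': "x' = 2 * X'" using \<open>even x'\<close> by blast
  obtain Y where Y: "y = 2 * Y + 1" using True assms(1) by (metis even_add oddE)
  obtain Y' where Y': "y' = 2 * Y' + 1" using \<open>even x'\<close> assms(2) by (metis even_add oddE)
  have "coarse X Y = coarse (X + (X' - X)) (Y + (Y' - Y))"
    using assms(4) by (simp add: pattern_def X X' Y Y')
  then have "coarse X Y < 2 * (\<bar>X' - X\<bar> + \<bar>Y' - Y\<bar>)"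
    using assms(3) by (intro coarse_packing) (auto simp: X X' Y Y')
  moreover have "\<bar>x' - x\<bar> = 2 * \<bar>X' - X\<bar>" "\<bar>y' - y\<bar> = 2 * \<bar>Y' - Y\<bar>"
    by (auto simp: X X' Y Y' abs_if)
  ultimately show ?thesis by (simp add: pattern_def X Y)
next
  case False
  have "odd x'"
    using assms(4) False pattern_coarse_iff by metis
  have "even y" "even y'" using assms(1,2) False \<open>odd x'\<close> by auto
  have "(x + y) mod 4 = (x' + y') mod 4"
  proof -
    have "((x + y) mod 4 = 1) = ((x' + y') mod 4 = 1)"
      using assms(4) False \<open>odd x'\<close> by (simp add: pattern_def split: if_splits)
    with assms(1,2) show ?thesis by presburger
  qed
  then have "4 dvd (x' - x) + (y' - y)" by presburger
  moreover have "even (x' - x)" "even (y' - y)"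
    using False \<open>odd x'\<close> \<open>even y\<close> \<open>even y'\<close> by auto
  moreover have "x' - x \<noteq> 0 \<or> y' - y \<noteq> 0" using assms(3) by auto
  ultimately have "3 < \<bar>x' - x\<bar> + \<bar>y' - y\<bar>" by presburger
  then show ?thesis using False by (simp add: pattern_def)
qed

section \<open>A packing coloring of the path with the colors 18 to 55\<close>

text \<open>
  The path is divided into its residue classes modulo 7. A class that uses \<open>m\<close> consecutive colors
  cyclically repeats a color at distance \<open>7 m\<close>, so all of these colors have to be below \<open>7 m\<close>. Giving
  each class in turn the next unused colors, with the least \<open>m\<close> allowed, leads to the numbers below.
  Seven classes work well because the largest color grows by a factor of about \<open>(7/6)\<^sup>7 \<approx> 2.94\<close>, close
  to the optimum \<open>e\<close>.
\<close>

definition path_starts :: "int list" where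
  "path_starts = [18, 21, 25, 30, 35, 41, 48]"

definition path_sizes :: "int list" where
  "path_sizes = [3, 4, 5, 5, 6, 7, 8]"

definition path_color :: "int \<Rightarrow> int" where
  "path_color b =
     path_starts ! nat (b mod 7) + (b div 7) mod (path_sizes ! nat (b mod 7))"

lemma path_intervals:
  assumes "i < 7"
  shows "0 < path_sizes ! i" "path_starts ! i + path_sizes ! i \<le> 7 * path_sizes ! i"
    "18 \<le> path_starts ! i" "path_starts ! i + path_sizes ! i \<le> 56"
  using assms by (auto simp: path_starts_def path_sizes_def less_Suc_eq numeral_eq_Suc)

lemma path_intervals_disjoint:
  assumes "i < j" "j < 7"
  shows "path_starts ! i + path_sizes ! i \<le> path_starts ! j"
  using assms by (auto simp: path_starts_def path_sizes_def less_Suc_eq numeral_eq_Suc)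

lemma path_color_interval:
  "path_starts ! nat (b mod 7) \<le> path_color b"
  "path_color b < path_starts ! nat (b mod 7) + path_sizes ! nat (b mod 7)"
  using path_intervals(1)[of "nat (b mod 7)"] by (auto simp: path_color_def nat_less_iff)

lemma path_color_range: "18 \<le> path_color b \<and> path_color b \<le> 55"
  using path_color_interval[of b] path_intervals[of "nat (b mod 7)"] by (auto simp: nat_less_iff)

lemma path_color_packing:
  assumes "b \<noteq> b'" "path_color b = path_color b'"
  shows "path_color b < \<bar>b' - b\<bar>"
proof -
  define i where "i = nat (b mod 7)"
  have i: "i < 7" by (simp add: i_def nat_less_iff)
  have "nat (b' mod 7) = i"
    using path_color_interval[of b] path_color_interval[of b'] assms(2)
      path_intervals_disjoint[of i "nat (b' mod 7)"] path_intervals_disjoint[of "nat (b' mod 7)" i] i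
    by (cases i "nat (b' mod 7)" rule: linorder_cases) (auto simp: i_def nat_less_iff)
  then have same: "b' mod 7 = b mod 7" by (simp add: i_def)
  then have "(b' div 7) mod (path_sizes ! i) = (b div 7) mod (path_sizes ! i)"
    using assms(2) by (simp add: path_color_def i_def)
  then obtain d where d: "b' div 7 - b div 7 = path_sizes ! i * d"
    by (metis mod_eq_dvd_iff dvdE)
  have diff: "b' - b = 7 * (path_sizes ! i * d)"
    using same d by (metis (no_types) add_diff_cancel_right mult_div_mod_eq right_diff_distrib)
  with assms(1) have "d \<noteq> 0" by auto
  then have "1 \<le> \<bar>d\<bar>" by simp
  with path_intervals(1)[OF i] have "path_sizes ! i \<le> path_sizes ! i * \<bar>d\<bar>" by simp
  moreover have "7 * (path_sizes ! i * \<bar>d\<bar>) = \<bar>b' - b\<bar>"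
    using path_intervals(1)[OF i] by (simp add: diff abs_mult)
  ultimately show ?thesis
    using path_intervals(2)[OF i] path_color_interval(2)[of b, folded i_def] by linarith
qed


section \<open>The coloring of the unrolled cylinder\<close>

text \<open>
  In each block of \<open>t\<close> columns, the columns are numbered by their residue \<open>r\<close>. The defect column is
  \<open>r = 0\<close>, and the \<open>S\<close> seams are \<open>r = 36, 56, 76, \<dots>\<close>. A seam has the colors up to 35, so 36 is a
  sufficient distance from the defect column; on the other side the last of 42 seams, at
  \<open>36 + 41 * 20 = 856\<close>, is still at least \<open>898 - 856 = 42\<close> away from the next one. The distance 20
  between neighboring seams is smaller than that; their colorings are shifted vertically by half a
  period against each other.

  \<open>seams_left S r\<close> counts the seams at residues less than \<open>r\<close>.
\<close>

definition seams_left :: "int \<Rightarrow> int \<Rightarrow> int" where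
  "seams_left S r = max 0 (min S ((r + 3) div 20 - 1))"

definition seam :: "int \<Rightarrow> int \<Rightarrow> int \<Rightarrow> bool" where
  "seam t S a \<longleftrightarrow>
     a mod t mod 20 = 16 \<and> 1 \<le> a mod t div 20 \<and> a mod t div 20 \<le> S"

definition pos_x :: "int \<Rightarrow> int \<Rightarrow> int \<Rightarrow> int" where
  "pos_x t S a = (t - 1 - S) * (a div t)
     + (if t dvd a then 0 else a mod t - 1 - seams_left S (a mod t))"

text \<open>
  The first \<open>I\<close> seams slide one way, the others back, so that after \<open>n\<close> seams the slide is \<open>n\<close> or
  \<open>I - (n - I)\<close>, whichever is less.
\<close>

definition shift_y :: "int \<Rightarrow> int \<Rightarrow> int \<Rightarrow> int \<Rightarrow> int" where
  "shift_y t S I a = (2 * I - S) * (a div t)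
     + min (seams_left S (a mod t)) (2 * I - seams_left S (a mod t))"

text \<open>
  Moving by \<open>(t, - k)\<close> leaves \<open>h = b + k (a div t)\<close> unchanged. Defect and seam columns are colored in
  terms of \<open>h\<close> and not of \<open>b\<close>, which makes their colors invariant for every \<open>t\<close> and \<open>k\<close>. A seam
  repeats its colors with period 36, and neighboring seams are out of phase by 18.
\<close>

definition cylinder_color :: "int \<Rightarrow> int \<Rightarrow> int \<Rightarrow> int \<Rightarrow> int \<Rightarrow> int \<Rightarrow> int" where
  "cylinder_color k t S I a b =
     (let x = pos_x t S a; y = b + shift_y t S I a; h = b + k * (a div t)
      in if t dvd a then path_color h
         else if even (x + y) then 1
         else if seam t S a then 18 + ((h + 18 * (a mod t div 20)) mod 36) div 2
         else pattern x y)"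

lemma seams_left_step:
  assumes "0 \<le> S"
  shows "seams_left S (r + 1) =
    seams_left S r + (if r mod 20 = 16 \<and> 1 \<le> r div 20 \<and> r div 20 \<le> S then 1 else 0)"
proof (cases "r mod 20 = 16")
  case True
  define q where "q = r div 20"
  have r: "r = 20 * q + 16" using mult_div_mod_eq[of 20 r] True unfolding q_def by linarith
  have "(r + 1 + 3) div 20 = q + 1" "(r + 3) div 20 = q" unfolding r by simp_all
  then have "seams_left S (r + 1) = max 0 (min S q)" "seams_left S r = max 0 (min S (q - 1))"
    unfolding seams_left_def by simp_all
  then have "seams_left S (r + 1) = seams_left S r + (if 1 \<le> q \<and> q \<le> S then 1 else 0)"
    using assms by (simp only:) (simp add: max_def min_def)
  with True show ?thesis by (simp only: q_def if_True simp_thms)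
next
  case False
  define q where "q = (r + 3) div 20"
  define m where "m = (r + 3) mod 20"
  have split: "r + 3 = 20 * q + m" unfolding q_def m_def by (simp only: mult_div_mod_eq)
  have m: "0 \<le> m" "m < 20" unfolding m_def by simp_all
  have "m \<noteq> 19"
  proof
    assume "m = 19"
    with split have "r = 20 * q + 16" by linarith
    then have "r mod 20 = 16" by simp
    with False show False by blast
  qed
  with split m have "(r + 1 + 3) div 20 = q" by (intro int_div_pos_eq[where r = "m + 1"]) auto
  then have "(r + 1 + 3) div 20 = (r + 3) div 20" by (simp only: q_def)
  then have "seams_left S (r + 1) = seams_left S r" by (simp only: seams_left_def)
  with False show ?thesis by simp
qed

lemma seam_palette: "18 \<le> 18 + (w mod 36) div 2 \<and> 18 + (w mod 36) div 2 \<le> 35" for w :: int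
  by presburger

text \<open>
  Two points of the same color, at heights \<open>w\<close> and \<open>w + e\<close> on seams whose numbers differ by \<open>d\<close>, have
  equal height modulo 36 up to an error of 1 after correcting for the phases.
\<close>

lemma seam_palette_period:
  fixes w e d :: int
  assumes "(w mod 36) div 2 = ((w + e + 18 * d) mod 36) div 2"
  obtains m j where "e + 18 * d = 36 * m + j" "\<bar>j\<bar> \<le> 1"
proof -
  define z where "z = w + e + 18 * d"
  define j where "j = z mod 36 - w mod 36"
  have halves: "\<bar>y - x\<bar> \<le> 1" if "x div 2 = y div 2" for x y :: int
    using that by presburger
  have "\<bar>j\<bar> \<le> 1" unfolding j_def using assms by (intro halves) (simp only: z_def)
  moreover have "z - w = 36 * (z div 36 - w div 36) + j"
    using mult_div_mod_eq[of 36 z] mult_div_mod_eq[of 36 w]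
    unfolding j_def right_diff_distrib by linarith
  then have "e + 18 * d = 36 * (z div 36 - w div 36) + j" by (simp add: z_def)
  ultimately show ?thesis using that by blast
qed

locale cylinder =
  fixes k t S I :: int
  assumes t: "898 \<le> t" and S: "0 \<le> S" "S \<le> 42" and I: "0 \<le> I" "I \<le> S"
begin

abbreviation "X \<equiv> pos_x t S"
abbreviation "Y \<equiv> shift_y t S I"
abbreviation "F \<equiv> cylinder_color k t S I"

lemma seams_left_ends: "r \<le> 36 \<Longrightarrow> seams_left S r = 0" "t - 1 \<le> r \<Longrightarrow> seams_left S r = S"
  using S t by (auto simp: seams_left_def)

lemma column_cases:
  obtains (inner) r where "a mod t = r" "0 \<le> r" "r + 1 < t" "(a + 1) mod t = r + 1"
      "(a + 1) div t = a div t"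
    | (last) "a mod t = t - 1" "(a + 1) mod t = 0" "(a + 1) div t = a div t + 1"
proof (cases "a mod t = t - 1")
  case True
  have "a + 1 = t * (a div t + 1)"
    using mult_div_mod_eq[of t a] True by (simp add: algebra_simps)
  then show ?thesis using last True t by simp
next
  case False
  have r: "0 \<le> a mod t" "a mod t + 1 < t"
  proof -
    have "a mod t < t" using t by simp
    then show "a mod t + 1 < t" using False by linarith
    show "0 \<le> a mod t" using t by simp
  qed
  have a: "a + 1 = t * (a div t) + (a mod t + 1)"
    using mult_div_mod_eq[of t a] by simp
  have "(a + 1) mod t = a mod t + 1"
    using r by (metis mod_add_left_eq mod_pos_pos_trivial add_increasing2 zero_le_one)
  moreover have "(a + 1) div t = a div t"
    using r a by (intro int_div_pos_eq) auto
  ultimately show ?thesis using inner r by blast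
qed

lemma dvd_not_seam: "t dvd a \<Longrightarrow> \<not> seam t S a"
  by (auto simp: seam_def)

lemma seam_position:
  assumes "seam t S a"
  shows "36 \<le> a mod t" "a mod t \<le> 856" "a mod t mod 20 = 16"
  using assms S mult_div_mod_eq[of 20 "a mod t"] unfolding seam_def by linarith+

lemma step_dvd:
  assumes "t dvd a"
  shows "X (a + 1) = X a" "Y (a + 1) = Y a"
proof -
  have a: "a mod t = 0" "(a + 1) mod t = 1" "(a + 1) div t = a div t"
    using assms t by (cases rule: column_cases[of a]; simp)+
  have "\<not> t dvd a + 1" using a t by (simp add: dvd_eq_mod_eq_0)
  then show "X (a + 1) = X a" "Y (a + 1) = Y a"
    using assms a by (simp_all add: pos_x_def shift_y_def seams_left_ends)
qed

lemma step_inner: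
  assumes "\<not> t dvd a" "a mod t \<noteq> t - 1"
  defines "n \<equiv> seams_left S (a mod t)" and "m \<equiv> seams_left S (a mod t + 1)"
  shows "X (a + 1) = X a + 1 - (m - n)"
    "Y (a + 1) = Y a + (min m (2 * I - m) - min n (2 * I - n))"
proof -
  have a: "(a + 1) mod t = a mod t + 1" "(a + 1) div t = a div t" "0 \<le> a mod t"
    using assms(2) by (cases rule: column_cases[of a]; simp)+
  then have "\<not> t dvd a + 1" by (simp add: dvd_eq_mod_eq_0)
  with assms(1) a show "X (a + 1) = X a + 1 - (m - n)"
    "Y (a + 1) = Y a + (min m (2 * I - m) - min n (2 * I - n))"
    by (simp_all add: pos_x_def shift_y_def m_def n_def)
qed

lemma step_seam:
  assumes "seam t S a"
  shows "X (a + 1) = X a" "\<bar>Y (a + 1) - Y a\<bar> = 1"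
proof -
  have a: "a mod t \<noteq> t - 1" "\<not> t dvd a"
    using assms S t dvd_not_seam by (auto simp: seam_def)
  have "seams_left S (a mod t + 1) = seams_left S (a mod t) + 1"
    using assms seams_left_step[OF S(1), of "a mod t"] by (simp add: seam_def)
  with step_inner[OF a(2,1)] show "X (a + 1) = X a" "\<bar>Y (a + 1) - Y a\<bar> = 1"
    by (simp_all add: min_def)
qed

lemma step_pattern:
  assumes "\<not> t dvd a" "\<not> seam t S a"
  shows "X (a + 1) = X a + 1" "Y (a + 1) = Y a"
proof -
  have "X (a + 1) = X a + 1 \<and> Y (a + 1) = Y a"
  proof (cases "a mod t = t - 1")
    case False
    have "seams_left S (a mod t + 1) = seams_left S (a mod t)"
      using assms(2) seams_left_step[OF S(1), of "a mod t"] unfolding seam_def by simp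
    with step_inner[OF assms(1) False] show ?thesis by simp
  next
    case True
    then have a: "(a + 1) mod t = 0" "(a + 1) div t = a div t + 1"
      using t by (cases rule: column_cases[of a]; simp)+
    have "t dvd a + 1" using a(1) by (rule mod_0_imp_dvd)
    then have "X (a + 1) = (t - 1 - S) * (a div t + 1)"
      "Y (a + 1) = (2 * I - S) * (a div t + 1) + min 0 (2 * I)"
      using a by (simp_all add: pos_x_def shift_y_def seams_left_ends)
    moreover have "seams_left S (t - 1) = S" by (rule seams_left_ends) simp
    then have "X a = (t - 1 - S) * (a div t) + (t - 1 - 1 - S)"
      "Y a = (2 * I - S) * (a div t) + min S (2 * I - S)"
      using assms(1) by (simp_all only: pos_x_def shift_y_def True if_False)
    moreover have "min 0 (2 * I) = 0" "min S (2 * I - S) = 2 * I - S" using I by auto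
    ultimately show ?thesis by (simp add: distrib_left)
  qed
  then show "X (a + 1) = X a + 1" "Y (a + 1) = Y a" by auto
qed

lemma step:
  "0 \<le> X (a + 1) - X a" "\<bar>Y (a + 1) - Y a\<bar> \<le> 1 - (X (a + 1) - X a)"
  using step_dvd[of a] step_seam[of a] step_pattern[of a]
  by (cases "t dvd a"; cases "seam t S a"; simp)+

text \<open>
  From one column to the next, either the first coordinate in the pattern advances by one and the
  slide stays the same, or the first coordinate stays and the slide changes by at most one. Hence the
  two changes together never exceed the number of columns passed.
\<close>

lemma contraction:
  assumes "a \<le> a'"
  shows "0 \<le> X a' - X a" "\<bar>Y a' - Y a\<bar> \<le> a' - a - (X a' - X a)"
proof -
  have "0 \<le> X a' - X a \<and> \<bar>Y a' - Y a\<bar> \<le> a' - a - (X a' - X a)"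
    using assms
  proof (induction a' rule: int_ge_induct)
    case (step i)
    then show ?case using cylinder.step[OF cylinder_axioms, of i] by linarith
  qed simp
  then show "0 \<le> X a' - X a" "\<bar>Y a' - Y a\<bar> \<le> a' - a - (X a' - X a)" by auto
qed

text \<open>
  This is why sliding seams keep the checkerboard intact: a column either advances the pattern or
  slides it, and both change the parity of \<open>X + Y\<close>. At a defect column neither happens.
\<close>

lemma parity_step:
  assumes "\<not> t dvd a"
  shows "even (X (a + 1) + Y (a + 1)) \<longleftrightarrow> odd (X a + Y a)"
proof (cases "seam t S a")
  case True
  then have "Y (a + 1) = Y a + 1 \<or> Y (a + 1) = Y a - 1"
    using step_seam(2) by fastforce
  with step_seam(1)[OF True] show ?thesis by auto
next
  case False
  with assms show ?thesis by (auto simp: step_pattern)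
qed

lemma seam_far_from_defect:
  assumes "t dvd a" "seam t S a'"
  shows "36 \<le> \<bar>a' - a\<bar>"
proof -
  define r where "r = a' mod t"
  have r: "36 \<le> r" "r \<le> 856"
    using seam_position[OF assms(2)] by (simp_all add: r_def)
  obtain q where a: "a = t * q" using assms(1) by blast
  define d where "d = a' div t - q"
  have diff: "a' - a = t * d + r"
    using mult_div_mod_eq[of t a'] by (simp add: a d_def r_def algebra_simps)
  consider "d \<le> -1" | "d = 0" | "1 \<le> d" by linarith
  then show ?thesis
  proof cases
    case 1
    then have "t * d \<le> t * (-1)" using t by (intro mult_left_mono) auto
    with diff r t show ?thesis by linarith
  next
    case 2
    with diff r show ?thesis by simp
  next
    case 3
    then have "t * 1 \<le> t * d" using t by (intro mult_left_mono) auto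
    with diff r t show ?thesis by linarith
  qed
qed

lemma defect_columns_far:
  assumes "t dvd a" "t dvd a'" "a \<noteq> a'"
  shows "t \<le> \<bar>a' - a\<bar>"
  using assms t by (metis abs_of_nonneg dvd_diff dvd_imp_le_int order_trans right_minus_eq zero_le_numeral)

lemma near_seams:
  assumes "seam t S a" "seam t S a'" "\<bar>a' - a\<bar> < 36"
  shows "a' div t = a div t \<and> a' - a = 20 * (a' mod t div 20 - a mod t div 20)"
proof -
  define r where "r = a mod t"
  define r' where "r' = a' mod t"
  have r: "36 \<le> r" "r \<le> 856" "36 \<le> r'" "r' \<le> 856" "r mod 20 = 16" "r' mod 20 = 16"
    using seam_position[OF assms(1)] seam_position[OF assms(2)] by (simp_all add: r_def r'_def)
  define d where "d = a' div t - a div t"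
  have diff: "a' - a = t * d + (r' - r)"
    using mult_div_mod_eq[of t a'] mult_div_mod_eq[of t a]
    by (simp add: d_def r_def r'_def algebra_simps)
  consider "d \<le> -1" | "d = 0" | "1 \<le> d" by linarith
  then show ?thesis
  proof cases
    case 1
    then have "t * d \<le> t * (-1)" using t by (intro mult_left_mono) auto
    with diff r t assms(3) show ?thesis by linarith
  next
    case 2
    have "r = 20 * (r div 20) + 16" "r' = 20 * (r' div 20) + 16"
      using mult_div_mod_eq[of 20 r] mult_div_mod_eq[of 20 r'] by (simp_all only: r(5,6))
    then have "r' - r = 20 * (r' div 20 - r div 20)" unfolding right_diff_distrib by linarith
    with 2 diff show ?thesis by (simp add: d_def r_def r'_def)
  next
    case 3
    then have "t * 1 \<le> t * d" using t by (intro mult_left_mono) auto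
    with diff r t assms(3) show ?thesis by linarith
  qed
qed

lemma color_dvd: "t dvd a \<Longrightarrow> F a b = path_color (b + k * (a div t))"
  by (simp only: cylinder_color_def Let_def if_True)

lemma color_even: "\<not> t dvd a \<Longrightarrow> even (X a + (b + Y a)) \<Longrightarrow> F a b = 1"
  by (simp only: cylinder_color_def Let_def if_True if_False)

lemma color_odd:
  assumes "\<not> t dvd a" "odd (X a + (b + Y a))"
  shows "seam t S a \<Longrightarrow>
      F a b = 18 + ((b + k * (a div t) + 18 * (a mod t div 20)) mod 36) div 2"
    "\<not> seam t S a \<Longrightarrow> F a b = pattern (X a) (b + Y a)"
  using assms by (simp_all only: cylinder_color_def Let_def if_True if_False)

lemma color_seam:
  assumes "seam t S a" "F a b \<noteq> 1"
  shows "F a b = 18 + ((b + k * (a div t) + 18 * (a mod t div 20)) mod 36) div 2"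
    "18 \<le> F a b" "F a b \<le> 35" "odd (X a + (b + Y a))"
proof -
  have nd: "\<not> t dvd a" using assms(1) dvd_not_seam by blast
  show odd: "odd (X a + (b + Y a))" using assms(2) nd color_even by blast
  show eq: "F a b = 18 + ((b + k * (a div t) + 18 * (a mod t div 20)) mod 36) div 2"
    by (rule color_odd(1)[OF nd odd assms(1)])
  show "18 \<le> F a b" "F a b \<le> 35" unfolding eq using seam_palette by blast+
qed

lemma color_pattern:
  assumes "\<not> t dvd a" "\<not> seam t S a" "F a b \<noteq> 1"
  shows "F a b = pattern (X a) (b + Y a)" "2 \<le> F a b" "F a b \<le> 17" "odd (X a + (b + Y a))"
proof -
  show odd: "odd (X a + (b + Y a))" using assms color_even by blast
  show eq: "F a b = pattern (X a) (b + Y a)"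
    by (rule color_odd(2)[OF assms(1) odd assms(2)])
  show "2 \<le> F a b" "F a b \<le> 17" unfolding eq using pattern_range by auto
qed

lemma color_eq_1_iff: "F a b = 1 \<longleftrightarrow> \<not> t dvd a \<and> even (X a + (b + Y a))"
proof (cases "t dvd a")
  case True
  then show ?thesis using color_dvd[of a b] path_color_range[of "b + k * (a div t)"] by auto
next
  case nd: False
  show ?thesis
  proof (cases "even (X a + (b + Y a))")
    case True
    with nd show ?thesis using color_even by blast
  next
    case odd: False
    have "F a b \<noteq> 1"
    proof (cases "seam t S a")
      case True
      have "18 \<le> F a b" unfolding color_odd(1)[OF nd odd True] using seam_palette by blast
      then show ?thesis by simp
    next
      case False
      then show ?thesis
        using color_odd(2)[OF nd odd False] pattern_range[of "X a" "b + Y a"] by simp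
    qed
    with odd show ?thesis by blast
  qed
qed

lemma color_range: "1 \<le> F a b \<and> F a b \<le> 55"
proof (cases "F a b = 1")
  case False
  consider "t dvd a" | "seam t S a" | "\<not> t dvd a" "\<not> seam t S a" by blast
  then show ?thesis
  proof cases
    case 1
    then show ?thesis
      using color_dvd[of a b] path_color_range[of "b + k * (a div t)"] by simp
  next
    case 2
    from color_seam(2,3)[OF this False] show ?thesis by linarith
  next
    case 3
    from color_pattern(2,3)[OF this False] show ?thesis by linarith
  qed
qed simp

lemma packing_defect:
  assumes "t dvd a" "(a, b) \<noteq> (a', b')" "F a b = F a' b'"
  shows "F a b < \<bar>a' - a\<bar> + \<bar>b' - b\<bar>"
proof -
  have range: "18 \<le> F a b" "F a b \<le> 55"
    using color_dvd[OF assms(1)] path_color_range by auto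
  consider "t dvd a'" "a' = a" | "t dvd a'" "a' \<noteq> a" | "\<not> t dvd a'" "seam t S a'"
    using color_pattern(3)[of a' b'] range assms(3) by fastforce
  then show ?thesis
  proof cases
    case 1
    then show ?thesis
      using assms path_color_packing[of "b + k * (a div t)" "b' + k * (a div t)"]
      by (simp add: color_dvd)
  next
    case 2
    with defect_columns_far[OF assms(1), of a'] t range show ?thesis by linarith
  next
    case 3
    then have "F a b \<le> 35" using color_seam(3)[of a' b'] range assms(3) by simp
    with seam_far_from_defect[OF assms(1) 3(2)] show ?thesis by linarith
  qed
qed

text \<open>
  Seams other than neighbors are at distance at least 40. Neighbors contribute 20 horizontally and at
  least 17 vertically. Within one seam, color 1 takes every second point, so the heights of two
  points of the same other color differ by an even number and hence by a multiple of 36.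
\<close>

lemma packing_seams:
  assumes "seam t S a" "seam t S a'" "(a, b) \<noteq> (a', b')" "F a b = F a' b'" "F a b \<noteq> 1"
  shows "F a b < \<bar>a' - a\<bar> + \<bar>b' - b\<bar>"
proof (cases "\<bar>a' - a\<bar> < 36")
  case False
  then show ?thesis using color_seam(3)[OF assms(1,5)] by linarith
next
  case True
  define i where "i = a mod t div 20"
  define i' where "i' = a' mod t div 20"
  define d where "d = i' - i"
  define h where "h = k * (a div t)"
  define w where "w = b + h + 18 * i"
  have near: "a' div t = a div t" "a' - a = 20 * d"
    using near_seams[OF assms(1,2) True] by (simp_all only: d_def i_def i'_def)
  have "d = 0 \<or> \<bar>d\<bar> = 1" using True near(2) by linarith
  have "F a' b' \<noteq> 1" using assms(4,5) by simp
  have "(w mod 36) div 2 = ((b' + h + 18 * i') mod 36) div 2"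
    using color_seam(1)[OF assms(1,5)] color_seam(1)[OF assms(2) \<open>F a' b' \<noteq> 1\<close>] assms(4)
    by (simp only: near(1) flip: i_def i'_def h_def w_def)
  moreover have "b' + h + 18 * i' = w + (b' - b) + 18 * d"
    by (simp add: w_def d_def)
  ultimately have "(w mod 36) div 2 = ((w + (b' - b) + 18 * d) mod 36) div 2"
    by (simp only:)
  then obtain m j where mj: "b' - b + 18 * d = 36 * m + j" "\<bar>j\<bar> \<le> 1"
    by (rule seam_palette_period)
  show ?thesis
  proof (cases "d = 0")
    case True
    then have a: "a' = a" using near(2) by simp
    have "even (b' - b)"
      using color_seam(4)[OF assms(1,5)] color_seam(4)[OF assms(2) \<open>F a' b' \<noteq> 1\<close>]
      by (auto simp: a)
    moreover have eq: "b' - b = 36 * m + j" using mj(1) True by simp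
    ultimately have "even j" by simp
    then have "j = 0" using mj(2) by presburger
    with eq have eq: "b' - b = 36 * m" by simp
    moreover have "b' - b \<noteq> 0" using assms(3) a by simp
    ultimately have "1 \<le> \<bar>m\<bar>" by simp
    then have "36 \<le> \<bar>b' - b\<bar>" unfolding eq by (simp add: abs_mult)
    then show ?thesis using color_seam(3)[OF assms(1,5)] by linarith
  next
    case False
    with \<open>d = 0 \<or> \<bar>d\<bar> = 1\<close> have d: "d = 1 \<or> d = -1" by linarith
    then have "17 \<le> \<bar>b' - b\<bar>"
    proof
      assume "d = 1"
      with mj show ?thesis by (cases "m \<le> 0"; linarith)
    next
      assume "d = -1"
      with mj show ?thesis by (cases "m \<le> -1"; linarith)
    qed
    moreover have "\<bar>a' - a\<bar> = 20" using near(2) d by auto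
    ultimately show ?thesis using color_seam(3)[OF assms(1,5)] by linarith
  qed
qed

text \<open>
  Columns of the pattern are not identified by \<open>X\<close>, which advances at each of them. So distinct points
  stay distinct in the pattern, and by \<open>contraction\<close> they were at least as far apart in the grid.
\<close>

lemma packing_pattern:
  assumes "a \<le> a'" "\<not> t dvd a" "\<not> seam t S a" "\<not> t dvd a'" "\<not> seam t S a'"
    and "(a, b) \<noteq> (a', b')" "F a b = F a' b'" "F a b \<noteq> 1"
  shows "F a b < \<bar>a' - a\<bar> + \<bar>b' - b\<bar>"
proof -
  note c = color_pattern[OF assms(2,3,8)]
  have "F a' b' \<noteq> 1" using assms(7,8) by simp
  note c' = color_pattern[OF assms(4,5) this]
  have "(X a, b + Y a) \<noteq> (X a', b' + Y a')"
  proof (cases "a = a'")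
    case False
    with assms(1) have "0 \<le> X a' - X (a + 1)" by (intro contraction) simp
    then show ?thesis using step_pattern(1)[OF assms(2,3)] by auto
  qed (use assms(6) in auto)
  then have "F a b < \<bar>X a' - X a\<bar> + \<bar>b' + Y a' - (b + Y a)\<bar>"
    using pattern_packing[OF c(4) c'(4)] c(1) c'(1) assms(7) by simp
  with contraction[OF assms(1)] assms(1) show ?thesis by linarith
qed

lemma packing_one:
  assumes "a \<le> a'" "(a, b) \<noteq> (a', b')" "F a b = 1" "F a' b' = 1"
  shows "1 < \<bar>a' - a\<bar> + \<bar>b' - b\<bar>"
proof (rule ccontr)
  assume "\<not> ?thesis"
  with assms(1,2) consider "a' = a" "\<bar>b' - b\<bar> = 1" | "a' = a + 1" "b' = b"
    by (cases "a' = a") auto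
  then show False
  proof cases
    case 1
    then have "b' = b + 1 \<or> b' = b - 1" by linarith
    with 1(1) assms(3,4) show False by (auto simp: color_eq_1_iff)
  next
    case 2
    with assms(3,4) parity_step[of a] show False by (auto simp: color_eq_1_iff)
  qed
qed

lemma packing_ordered:
  assumes "a \<le> a'" "(a, b) \<noteq> (a', b')" "F a b = F a' b'"
  shows "F a b < \<bar>a' - a\<bar> + \<bar>b' - b\<bar>"
proof (cases "F a b = 1")
  case True
  then show ?thesis using packing_one[OF assms(1,2)] assms(3) by simp
next
  case False
  consider "t dvd a" | "t dvd a'" | "\<not> t dvd a" "\<not> t dvd a'" by blast
  then show ?thesis
  proof cases
    case 1
    then show ?thesis using packing_defect assms by blast
  next
    case 2
    then show ?thesis using packing_defect[of a' b' a b] assms by (simp add: abs_minus_commute eq_commute)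
  next
    case 3
    have "seam t S a \<longleftrightarrow> seam t S a'"
      using color_seam(2)[of a b] color_seam(2)[of a' b'] color_pattern(3)[OF 3(1), of b]
        color_pattern(3)[OF 3(2), of b'] False assms(3) by fastforce
    then show ?thesis using packing_seams packing_pattern 3 assms False by blast
  qed
qed

lemma plane_packing_color: "plane_packing F"
  unfolding plane_packing_def
proof (intro allI impI)
  fix a b a' b'
  assume *: "(a, b) \<noteq> (a', b')" "F a b = F a' b'"
  show "F a b < \<bar>a' - a\<bar> + \<bar>b' - b\<bar>"
    using packing_ordered[of a a' b b'] packing_ordered[of a' a b' b] * by fastforce
qed

text \<open>
  The two assumptions say that the displacement in the pattern after one block lies in the lattice of
  \<open>pattern_period\<close>.
\<close>

lemma color_period:
  assumes "4 dvd 2 * I - S - k" "256 dvd t - 1 - S - 19 * (2 * I - S - k)"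
  shows "F (a + t) (b - k) = F a b"
proof -
  define u where "u = t - 1 - S"
  define v where "v = 2 * I - S - k"
  have period: "4 dvd v" "256 dvd u - 19 * v" using assms by (simp_all only: u_def v_def)
  then obtain p q where "v = 4 * p" "u - 19 * v = 256 * q" by (elim dvdE)
  then have even: "even v" "even u" by presburger+
  have div: "(a + t) div t = a div t + 1" and mod: "(a + t) mod t = a mod t"
    and dvd: "t dvd a + t \<longleftrightarrow> t dvd a"
    using t by simp_all
  have x: "X (a + t) = X a + u"
    unfolding pos_x_def div mod dvd u_def distrib_left by (simp only: mult_1_right mult_1_left ac_simps)
  have y: "b - k + Y (a + t) = b + Y a + v"
    unfolding shift_y_def div mod v_def distrib_left by simp
  have "X a + u + (b + Y a + v) = X a + (b + Y a) + (u + v)" by simp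
  then have parity: "even (X a + u + (b + Y a + v)) \<longleftrightarrow> even (X a + (b + Y a))"
    using even by simp
  have seam: "seam t S (a + t) = seam t S a" by (simp only: seam_def mod)
  have height: "b - k + k * (a div t + 1) = b + k * (a div t)" by (simp add: algebra_simps)
  show ?thesis
    by (simp only: cylinder_color_def Let_def dvd div mod seam x y parity height
        pattern_period[OF period])
qed

end

section \<open>Choosing the number and the slide of the seams\<close>

text \<open>
  Let \<open>D = 2 I - S\<close> be the total slide. The displacement after one block is a period iff
  \<open>D \<equiv> k\<close> modulo 4 and \<open>S + 19 D \<equiv> t - 1 + 19 k\<close> modulo 256. Here \<open>D\<close> and \<open>S\<close> are odd because \<open>k\<close> is
  odd and \<open>t\<close> is even, and the right-hand side is an even number \<open>2 h\<close>. So there are only 128 values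
  of \<open>h\<close> and two of \<open>k mod 4\<close> to consider.
\<close>

definition tilt_ok :: "int \<Rightarrow> int \<Rightarrow> int \<Rightarrow> bool" where
  "tilt_ok e h d \<longleftrightarrow>
     (let D = 2 * d + 1; S = (2 * h - 19 * D) mod 256
      in S \<le> 42 \<and> \<bar>D\<bar> \<le> S \<and> (D - e) mod 4 = 0)"

definition some_tilt_ok :: "int \<Rightarrow> int \<Rightarrow> bool" where
  "some_tilt_ok e h \<longleftrightarrow> list_ex (tilt_ok e h) [-21..20]"

lemma some_tilts_ok:
  "list_all (some_tilt_ok 1) [0..127]" "list_all (some_tilt_ok 3) [0..127]"
  by code_simp+

lemma seam_numbers:
  fixes k t :: int
  assumes "odd k" "even t"
  obtains S I where "0 \<le> I" "I \<le> S" "S \<le> 42"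
    "4 dvd 2 * I - S - k" "256 dvd t - 1 - S - 19 * (2 * I - S - k)"
proof -
  define c where "c = (t - 1 + 19 * k) mod 256"
  have "even c" using assms unfolding c_def by (simp add: dvd_mod_iff)
  then obtain h where h: "c = 2 * h" by blast
  have "0 \<le> c" "c < 256" by (simp_all add: c_def)
  then have "h \<in> set [0..127]" by (simp add: h)
  moreover have "k mod 4 = 1 \<or> k mod 4 = 3" using assms(1) by presburger
  ultimately have "some_tilt_ok (k mod 4) h" using some_tilts_ok by (auto simp: list_all_iff)
  then obtain d where d: "tilt_ok (k mod 4) h d"
    by (auto simp: some_tilt_ok_def list_ex_iff)
  define D where "D = 2 * d + 1"
  define S where "S = (c - 19 * D) mod 256"
  have SD: "S \<le> 42" "\<bar>D\<bar> \<le> S" "(D - k mod 4) mod 4 = 0"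
    using d by (simp_all add: tilt_ok_def Let_def D_def S_def h)
  have "odd S" using \<open>even c\<close> unfolding S_def D_def by (simp add: dvd_mod_iff)
  then have "even (S + D)" by (simp add: D_def)
  then obtain I where I: "S + D = 2 * I" by blast
  then have D: "2 * I - S = D" by simp
  show ?thesis
  proof (rule that[of I S])
    show "0 \<le> I" "I \<le> S" using SD(2) I by linarith+
    show "S \<le> 42" by (fact SD)
    have "(D - k) mod 4 = 0" using SD(3) by (simp only: mod_diff_right_eq)
    then show "4 dvd 2 * I - S - k" unfolding D by (rule mod_0_imp_dvd)
    have "256 dvd (c - 19 * D) - S" unfolding S_def by (simp add: minus_mod_eq_mult_div)
    moreover have "256 dvd (t - 1 + 19 * k) - c" unfolding c_def by (simp add: minus_mod_eq_mult_div)
    ultimately have "256 dvd ((c - 19 * D) - S) + ((t - 1 + 19 * k) - c)" by (rule dvd_add)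
    then show "256 dvd t - 1 - S - 19 * (2 * I - S - k)"
      unfolding D by (simp add: algebra_simps)
  qed
qed

theorem theorem3:
  fixes k t :: nat
  assumes "0 < k" and "k < t"
    and "odd k" and "even t" and "898 \<le> t"
    and "coprime k t"
  shows "packing_chromatic_number (distance_graph k t) \<le> 56"
proof -
  have "odd (int k)" "even (int t)" using assms(3,4) by simp_all
  then obtain S I where SI: "0 \<le> I" "I \<le> S" "S \<le> 42"
    "4 dvd 2 * I - S - int k" "256 dvd int t - 1 - S - 19 * (2 * I - S - int k)"
    by (rule seam_numbers)
  interpret cylinder "int k" "int t" S I
    using SI assms(5) by unfold_locales auto
  have "packing_chromatic_number (distance_graph k t) \<le> enat 56"
  proof (rule packing_chromatic_number_le_plane_packing[OF assms(6) _ plane_packing_color])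
    show "0 < t" using assms(5) by simp
    show "1 \<le> F a b \<and> F a b \<le> int 56" for a b using color_range[of a b] by simp
    show "F (a + int t) (b - int k) = F a b" for a b using SI(4,5) by (rule color_period)
  qed
  then show ?thesis by (simp add: numeral_eq_enat)
qed

end
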